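(* Let $0<a_1<\dots<a_n$ be real numbers and let $\vec{C}=(c_1,\dots,c_n)$ be an ordering of them. Let $u=\lceil n/2\rceil$. Suppose that it is neither the case that $c_k<c_{n+2-k}$ for all $2\le k\le u$, nor the case that $c_k>c_{n+2-k}$ for all $2\le k\le u$. Let $\vec{C}'$ be obtained from $\vec{C}$ by interchanging the entries in positions $k$ and $n+2-k$ for every $k$ with $2\le k\le u$ and $c_k<c_{n+2-k}$ (and leaving all other entries unchanged), so that $\vec{C}'$ satisfies $c'_k>c'_{n+2-k}$ for all $2\le k\le u$ (the sum-`$n+2$' transform). Then $f(\vec{C}')>f(\vec{C})$.
   Context: For an ordering $\vec{C}=(c_1,\dots,c_n)$ of $a_1,\dots,a_n$, its partial sums are $s_k=\sum_{i=1}^k c_i$, with mean $\overline{S}=\frac1n\sum_{k=1}^n s_k$, and $f(\vec{C})=\frac1n\sum_{k=1}^n (s_k-\overline{S})^2$ is the variance of the partial sums. *)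

theory Defs
  imports Complex_Main "HOL-Combinatorics.Permutations"
begin

text \<open>
  A sequence of length \<open>n\<close> is a function on \<^typ>\<open>nat\<close> of which only the values at the positions
  \<open>1, \<dots>, n\<close> matter.
\<close>

definition is_ordering :: "nat \<Rightarrow> (nat \<Rightarrow> real) \<Rightarrow> (nat \<Rightarrow> real) \<Rightarrow> bool" where
  "is_ordering n a c \<longleftrightarrow> (\<exists>p. p permutes {1..n} \<and> (\<forall>k\<in>{1..n}. c k = a (p k)))"

definition partial_sum :: "(nat \<Rightarrow> real) \<Rightarrow> nat \<Rightarrow> real" where
  "partial_sum c k = (\<Sum>i=1..k. c i)"

definition mean_partial_sum :: "nat \<Rightarrow> (nat \<Rightarrow> real) \<Rightarrow> real" where
  "mean_partial_sum n c = (1 / real n) * (\<Sum>k=1..n. partial_sum c k)"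

definition var_partial_sum :: "nat \<Rightarrow> (nat \<Rightarrow> real) \<Rightarrow> real" where
  "var_partial_sum n c =
     (1 / real n) * (\<Sum>k=1..n. (partial_sum c k - mean_partial_sum n c)\<^sup>2)"

definition half_up :: "nat \<Rightarrow> nat" where
  "half_up n = nat \<lceil>real n / 2\<rceil>"

text \<open>
  For \<open>2 \<le> k \<le> half_up n\<close> one has \<open>k < n + 2 - k \<le> n\<close>, so the pairs of positions \<open>k\<close>, \<open>n + 2 - k\<close>
  are pairwise disjoint, lie within \<open>{2..n}\<close>, and \<open>i \<mapsto> n + 2 - i\<close> swaps the two members of each.
\<close>

definition sum_n2_transform :: "nat \<Rightarrow> (nat \<Rightarrow> real) \<Rightarrow> nat \<Rightarrow> real" where
  "sum_n2_transform n c i =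
     (if \<exists>k\<in>{2..half_up n}. c k < c (n + 2 - k) \<and> (i = k \<or> i = n + 2 - k)
      then c (n + 2 - i) else c i)"

end

theory Submission
  imports Defs
begin

text \<open>
  The variance is, up to a factor, the sum of all \<open>(s\<^sub>j - s\<^sub>k)\<^sup>2\<close>. It splits into the contributions of
  the parts of \<open>s\<close> that are symmetric and antisymmetric under \<open>k \<mapsto> n + 1 - k\<close>. Up to constants, these
  parts are the partial sums of \<open>c\<^sub>i - c\<^bsub>n+2-i\<^esub>\<close> and of \<open>c\<^sub>i + c\<^bsub>n+2-i\<^esub>\<close>, starting at \<open>i = 2\<close>. The transform
  fixes the latter and replaces the differences \<open>c\<^sub>i - c\<^bsub>n+2-i\<^esub>\<close> in the first half by their absolute
  values. Hence no \<open>\<bar>s\<^sub>j - s\<^sub>k\<bar>\<close> of the symmetric part decreases, and if both signs occur, the one between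
  the two ends of the first half grows.
\<close>

section \<open>Variance through pairwise differences\<close>

lemma sum_pair_diff_squared:
  fixes x :: "nat \<Rightarrow> real"
  shows "(\<Sum>j=1..n. \<Sum>k=1..n. (x j - x k)\<^sup>2)
           = 2 * real n * (\<Sum>k=1..n. (x k)\<^sup>2) - 2 * (\<Sum>k=1..n. x k)\<^sup>2"
proof -
  have "(\<Sum>j=1..n. \<Sum>k=1..n. (x j - x k)\<^sup>2)
      = (\<Sum>j=1..n. real n * (x j)\<^sup>2 + (\<Sum>k=1..n. (x k)\<^sup>2) - 2 * (x j * (\<Sum>k=1..n. x k)))"
    by (intro sum.cong refl)
      (simp add: power2_diff sum.distrib sum_subtractf sum_distrib_left mult.assoc)
  also have "\<dots> = 2 * real n * (\<Sum>k=1..n. (x k)\<^sup>2) - 2 * (\<Sum>k=1..n. x k)\<^sup>2"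
    by (simp add: sum.distrib sum_subtractf power2_eq_square
        flip: sum_distrib_left sum_distrib_right)
  finally show ?thesis .
qed

text \<open>Eliminates the mean, which changes with the ordering, so that two orderings can be
  compared one pair of partial sums at a time.\<close>

lemma var_partial_sum_pairs:
  assumes "n > 0"
  shows "2 * (real n)\<^sup>2 * var_partial_sum n c
           = (\<Sum>j=1..n. \<Sum>k=1..n. (partial_sum c j - partial_sum c k)\<^sup>2)"
proof -
  define m where "m = mean_partial_sum n c"
  have m: "(\<Sum>k=1..n. partial_sum c k) = real n * m"
    using assms by (simp add: m_def mean_partial_sum_def)
  have "(\<Sum>k=1..n. (partial_sum c k - m)\<^sup>2)
      = (\<Sum>k=1..n. (partial_sum c k)\<^sup>2) + real n * m\<^sup>2 - 2 * m * (\<Sum>k=1..n. partial_sum c k)"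
    by (simp add: power2_diff sum.distrib sum_subtractf sum_distrib_left mult_ac)
  then show ?thesis
    using assms
    by (simp only: sum_pair_diff_squared var_partial_sum_def m flip: m_def)
      (simp add: power2_eq_square algebra_simps)
qed

text \<open>Twice \<open>x\<close> is its symmetric plus its antisymmetric part, and the two are
  orthogonal under the reflection. The antisymmetric part sums to zero, so its pair sum reduces to a
  sum of squares.\<close>

lemma sum_pair_diff_reflection:
  fixes x :: "nat \<Rightarrow> real"
  shows "4 * (\<Sum>j=1..n. \<Sum>k=1..n. (x j - x k)\<^sup>2)
      = (\<Sum>j=1..n. \<Sum>k=1..n. ((x j + x (n + 1 - j)) - (x k + x (n + 1 - k)))\<^sup>2)
        + 2 * real n * (\<Sum>k=1..n. (x k - x (n + 1 - k))\<^sup>2)"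
proof -
  have rev: "(\<Sum>k=1..n. g (n + 1 - k)) = (\<Sum>k=1..n. g k)" for g :: "nat \<Rightarrow> real"
    using sum.atLeastAtMost_rev[of g 1 n] by (simp add: add.commute)
  have 1: "(\<Sum>k=1..n. x k + x (n + 1 - k)) = 2 * (\<Sum>k=1..n. x k)"
    using rev[of x] by (simp add: sum.distrib)
  have "(\<Sum>k=1..n. (x k + x (n + 1 - k))\<^sup>2) + (\<Sum>k=1..n. (x k - x (n + 1 - k))\<^sup>2)
      = (\<Sum>k=1..n. 2 * (x k)\<^sup>2 + 2 * (x (n + 1 - k))\<^sup>2)"
    unfolding sum.distrib[symmetric]
    by (intro sum.cong refl) (simp add: power2_eq_square algebra_simps)
  also have "\<dots> = 4 * (\<Sum>k=1..n. (x k)\<^sup>2)"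
    using rev[of "\<lambda>k. (x k)\<^sup>2"] by (simp add: sum.distrib flip: sum_distrib_left)
  finally have 2: "(\<Sum>k=1..n. (x k + x (n + 1 - k))\<^sup>2)
      = 4 * (\<Sum>k=1..n. (x k)\<^sup>2) - (\<Sum>k=1..n. (x k - x (n + 1 - k))\<^sup>2)"
    by linarith
  show ?thesis
    unfolding sum_pair_diff_squared[of x] sum_pair_diff_squared[of "\<lambda>k. x k + x (n + 1 - k)"] 1 2
    by (simp add: power2_eq_square algebra_simps)
qed

section \<open>Partial sums under reflection\<close>

lemma partial_sum_split_first:
  assumes "k \<ge> 1"
  shows "partial_sum c k = c 1 + (\<Sum>i=2..k. c i)"
  using assms unfolding partial_sum_def
  by (subst sum.atLeast_Suc_atMost) (simp_all add: numeral_2_eq_2)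

text \<open>The entries missing from the shorter sum occupy the last \<open>k - 1\<close> positions,
  the partners of \<open>2..k\<close>. Reflecting the index of a partial sum in \<open>n + 1\<close>
  thus pairs entries by \<open>n + 2\<close>.\<close>

lemma partial_sum_reflect:
  assumes "k \<in> {1..n}"
  shows "partial_sum c (n + 1 - k) = partial_sum c n - (\<Sum>i=2..k. c (n + 2 - i))"
proof -
  have "(\<Sum>i=2..k. c (n + 2 - i)) = (\<Sum>i=n + 2 - k..n. c i)"
    using assms
    by (intro sum.reindex_bij_witness[of _ "\<lambda>i. n + 2 - i" "\<lambda>i. n + 2 - i"]) auto
  moreover have "{1..n} = {1..n + 1 - k} \<union> {n + 2 - k..n}" "{1..n + 1 - k} \<inter> {n + 2 - k..n} = {}"
    using assms by auto
  ultimately show ?thesis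
    unfolding partial_sum_def by (simp add: sum.union_disjoint)
qed

text \<open>Expresses the total by \<open>c 1\<close> and the pair sums, all of which the transform
  preserves.\<close>

lemma partial_sum_eq_pair_sums:
  assumes "n \<ge> 1"
  shows "2 * partial_sum c n = 2 * c 1 + (\<Sum>i=2..n. c i + c (n + 2 - i))"
proof -
  have "(\<Sum>i=2..n. c (n + 2 - i)) = (\<Sum>i=2..n. c i)"
    using sum.atLeastAtMost_rev[of c 2 n] by (simp add: add.commute)
  then show ?thesis
    using assms by (simp add: partial_sum_split_first sum.distrib)
qed

section \<open>The transform on pairs of positions\<close>

lemma half_up_eq: "half_up n = (n + 1) div 2"
  unfolding half_up_def by linarith

lemma is_ordering_inj_on:
  assumes "strict_mono_on {1..n} a" "is_ordering n a c"
  shows "inj_on c {1..n}"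
proof -
  obtain p where p: "p permutes {1..n}" and cp: "\<forall>k\<in>{1..n}. c k = a (p k)"
    using assms(2) unfolding is_ordering_def by blast
  have "inj_on (a \<circ> p) {1..n}"
    using p strict_mono_on_imp_inj_on[OF assms(1)]
    by (intro comp_inj_on) (auto simp: permutes_image permutes_inj_on)
  then show ?thesis
    by (rule inj_on_cong[THEN iffD1, rotated]) (simp add: cp)
qed

lemma sum_n2_transform_lower:
  assumes "k \<in> {2..half_up n}"
  shows "sum_n2_transform n c k = max (c k) (c (n + 2 - k))"
proof -
  have "(\<exists>j\<in>{2..half_up n}. c j < c (n + 2 - j) \<and> (k = j \<or> k = n + 2 - j)) \<longleftrightarrow> c k < c (n + 2 - k)"
    using assms by (auto simp: half_up_eq)
  then show ?thesis
    unfolding sum_n2_transform_def by simp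
qed

lemma sum_n2_transform_upper:
  assumes "k \<in> {2..half_up n}"
  shows "sum_n2_transform n c (n + 2 - k) = min (c k) (c (n + 2 - k))"
proof -
  have "j = k" if "n + 2 - k = n + 2 - j" "j \<in> {2..half_up n}" for j
    using that assms by (auto simp: half_up_eq)
  then have "(\<exists>j\<in>{2..half_up n}. c j < c (n + 2 - j) \<and> (n + 2 - k = j \<or> n + 2 - k = n + 2 - j))
      \<longleftrightarrow> c k < c (n + 2 - k)"
    using assms by (auto simp: half_up_eq)
  moreover have "n + 2 - (n + 2 - k) = k"
    using assms by (auto simp: half_up_eq)
  ultimately show ?thesis
    unfolding sum_n2_transform_def by simp
qed

lemma sum_n2_transform_first:
  "sum_n2_transform n c 1 = c 1"
  unfolding sum_n2_transform_def by (auto simp: half_up_eq)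

lemma sum_n2_transform_pair_sum:
  assumes "i \<in> {2..n}"
  shows "sum_n2_transform n c i + sum_n2_transform n c (n + 2 - i) = c i + c (n + 2 - i)"
proof -
  \<comment> \<open>For even \<open>n\<close> the middle position \<open>n div 2 + 1\<close> is its
    own partner and lies in neither half.\<close>
  have "i \<le> (n + 1) div 2 \<or> n + 2 - i \<le> (n + 1) div 2 \<or> n + 2 - i = i"
    by presburger
  then consider "i \<in> {2..half_up n}" | "n + 2 - i \<in> {2..half_up n}" | "n + 2 - i = i"
    using assms by (fastforce simp: half_up_eq)
  then show ?thesis
  proof cases
    case 1
    show ?thesis
      unfolding sum_n2_transform_lower[OF 1] sum_n2_transform_upper[OF 1] by simp
  next
    case 2
    moreover have "n + 2 - (n + 2 - i) = i"
      using assms by auto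
    ultimately show ?thesis
      using sum_n2_transform_lower[of "n + 2 - i" n c] sum_n2_transform_upper[of "n + 2 - i" n c]
      by (simp add: min_def max_def)
  next
    case 3
    then show ?thesis
      by (simp add: sum_n2_transform_def)
  qed
qed

section \<open>Sums of signed terms against sums of absolute values\<close>

text \<open>The negative term makes the upper bound on the sum strict, the positive term the lower
  one.\<close>

lemma abs_sum_less_sum_abs:
  fixes d :: "'a \<Rightarrow> real"
  assumes "finite A" "i \<in> A" "d i > 0" "j \<in> A" "d j < 0"
  shows "\<bar>sum d A\<bar> < (\<Sum>k\<in>A. \<bar>d k\<bar>)"
proof -
  have "sum d A < (\<Sum>k\<in>A. \<bar>d k\<bar>)"
    using assms by (intro sum_strict_mono_ex1 bexI[of _ j]) auto
  moreover have "(\<Sum>k\<in>A. - d k) < (\<Sum>k\<in>A. \<bar>d k\<bar>)"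
    using assms by (intro sum_strict_mono_ex1 bexI[of _ i]) auto
  ultimately show ?thesis
    by (simp add: sum_negf abs_less_iff)
qed

text \<open>Each difference is a sum over the indices between \<open>j\<close> and \<open>k\<close>,
  so this is the triangle inequality.\<close>

lemma abs_partial_sum_diff_le:
  fixes d :: "nat \<Rightarrow> real"
  assumes "j \<le> u" "k \<le> u"
  shows "\<bar>(\<Sum>i=2..j. d i) - (\<Sum>i=2..k. d i)\<bar> \<le> \<bar>(\<Sum>i=2..j. \<bar>d i\<bar>) - (\<Sum>i=2..k. \<bar>d i\<bar>)\<bar>"
proof -
  have *: "\<bar>(\<Sum>i=2..k. d i) - (\<Sum>i=2..j. d i)\<bar> \<le> \<bar>(\<Sum>i=2..k. \<bar>d i\<bar>) - (\<Sum>i=2..j. \<bar>d i\<bar>)\<bar>"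
    if "j \<le> k" for j k
  proof -
    have "sum g {2..k} - sum g {2..j} = sum g ({2..k} - {2..j})" for g :: "nat \<Rightarrow> real"
      using that by (subst sum_diff) auto
    then show ?thesis
      by (simp add: sum_abs)
  qed
  show ?thesis
    using *[of j k] *[of k j] by (cases "j \<le> k") (auto simp: abs_minus_commute)
qed

theorem theorem1:
  fixes n :: nat and a c c' :: "nat \<Rightarrow> real"
  assumes "0 < a 1"
    and "strict_mono_on {1..n} a"
    and "is_ordering n a c"
    and "\<not> (\<forall>k\<in>{2..half_up n}. c k < c (n + 2 - k))"
    and "\<not> (\<forall>k\<in>{2..half_up n}. c k > c (n + 2 - k))"
    and "c' = sum_n2_transform n c"
  shows "(\<forall>k\<in>{2..half_up n}. c' k > c' (n + 2 - k)) \<and>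
         var_partial_sum n c' > var_partial_sum n c"
proof -
  define u where "u = half_up n"
  define d where "d i = c i - c (n + 2 - i)" for i
  define d' where "d' i = c' i - c' (n + 2 - i)" for i
  have u: "u = (n + 1) div 2"
    by (simp add: u_def half_up_eq)
  have d'_eq: "d' k = \<bar>d k\<bar>" if "k \<in> {2..u}" for k
    unfolding d'_def d_def assms(6) sum_n2_transform_lower[OF that[unfolded u_def]]
      sum_n2_transform_upper[OF that[unfolded u_def]] by simp
  have d_nz: "d k \<noteq> 0" if "k \<in> {2..u}" for k
  proof -
    have "k \<in> {1..n}" "n + 2 - k \<in> {1..n}" "k \<noteq> n + 2 - k"
      using that by (auto simp: u)
    then show ?thesis
      using inj_on_contraD[OF is_ordering_inj_on[OF assms(2,3)]] unfolding d_def by simp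
  qed
  \<comment> \<open>No \<open>d k\<close> vanishes, so each excluded uniform sign pattern yields a
    difference of the opposite sign.\<close>
  obtain p where p: "p \<in> {2..u}" "d p > 0"
    using assms(4) d_nz unfolding d_def u_def
    by (metis diff_gt_0_iff_gt eq_iff_diff_eq_0 linorder_neqE)
  obtain q where q: "q \<in> {2..u}" "d q < 0"
    using assms(5) d_nz unfolding d_def u_def
    by (metis diff_less_0_iff_less eq_iff_diff_eq_0 linorder_neqE)
  have "n > 0" "u \<in> {1..n}"
    using p by (auto simp: u)

  have first: "c' 1 = c 1"
    unfolding assms(6) by (rule sum_n2_transform_first)
  have total: "partial_sum c' n = partial_sum c n"
    using partial_sum_eq_pair_sums[of n c] partial_sum_eq_pair_sums[of n c'] \<open>n > 0\<close>
    by (simp add: assms(6) sum_n2_transform_first[unfolded One_nat_def] sum_n2_transform_pair_sum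
        del: add_2_eq_Suc')
  \<comment> \<open>By reflection, both sides are \<open>c 1\<close> minus the total plus the pair
    sums up to \<open>k\<close>.\<close>
  have antisym: "partial_sum c' k - partial_sum c' (n + 1 - k)
      = partial_sum c k - partial_sum c (n + 1 - k)" if "k \<in> {1..n}" for k
  proof -
    have "(\<Sum>i=2..k. c' i + c' (n + 2 - i)) = (\<Sum>i=2..k. c i + c (n + 2 - i))"
      using that by (intro sum.cong refl) (simp add: assms(6) sum_n2_transform_pair_sum del: add_2_eq_Suc')
    then show ?thesis
      using that first partial_sum_reflect[of k n]
      by (simp add: partial_sum_split_first[of k] total sum.distrib)
  qed

  define P where "P b k = partial_sum b k + partial_sum b (n + 1 - k)" for b k
  \<comment> \<open>The same constant serves \<open>c\<close> and \<open>c'\<close>, as they share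
    first entry and total; it cancels in differences of \<open>P\<close>.\<close>
  define K where "K = c 1 + partial_sum c n"
  have P_sym: "P b (n + 1 - k) = P b k" if "k \<in> {1..n}" for b k
    using that by (simp add: P_def)
  have P_c: "P c k = K + (\<Sum>i=2..k. d i)" if "k \<in> {1..n}" for k
    using that partial_sum_reflect[of k n c]
    by (simp add: P_def K_def d_def partial_sum_split_first[of k] sum_subtractf)
  \<comment> \<open>The range stops at \<open>u\<close> because past the first half
    \<open>d'\<close> need not be the absolute value of \<open>d\<close>.\<close>
  have P_c': "P c' k = K + (\<Sum>i=2..k. \<bar>d i\<bar>)" if "k \<in> {1..u}" for k
  proof -
    have "k \<in> {1..n}"
      using that \<open>u \<in> {1..n}\<close> by auto
    moreover have "(\<Sum>i=2..k. \<bar>d i\<bar>) = (\<Sum>i=2..k. d' i)"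
      using that d'_eq by (intro sum.cong) auto
    ultimately show ?thesis
      using partial_sum_reflect[of k n c'] first that
      by (simp add: P_def K_def d'_def partial_sum_split_first[of k] sum_subtractf total)
  qed
  have P_le: "\<bar>P c j - P c k\<bar> \<le> \<bar>P c' j - P c' k\<bar>" if "j \<in> {1..n}" "k \<in> {1..n}" for j k
  proof -
    \<comment> \<open>By symmetry of \<open>P\<close>, every index can be moved into
      \<open>{1..u}\<close>, where both formulas for \<open>P\<close> hold.\<close>
    define fold where "fold i = (if i \<le> u then i else n + 1 - i)" for i
    have fold: "P b i = P b (fold i)" "fold i \<in> {1..u}" "fold i \<in> {1..n}" if "i \<in> {1..n}" for b i
      using that P_sym[of i b] by (auto simp: fold_def u)
    have "\<bar>P c (fold j) - P c (fold k)\<bar> \<le> \<bar>P c' (fold j) - P c' (fold k)\<bar>"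
      using fold(2,3)[OF that(1)] fold(2,3)[OF that(2)]
        abs_partial_sum_diff_le[of "fold j" u "fold k" d]
      by (simp add: P_c P_c')
    then show ?thesis
      using fold(1) that by metis
  qed
  \<comment> \<open>From \<open>1\<close> to \<open>u\<close> the difference collects all of
    \<open>{2..u}\<close>, hence both the positive \<open>d p\<close> and the negative
    \<open>d q\<close>.\<close>
  have P_less: "\<bar>P c u - P c 1\<bar> < \<bar>P c' u - P c' 1\<bar>"
    using abs_sum_less_sum_abs[of "{2..u}" p d q] p q \<open>u \<in> {1..n}\<close> \<open>n > 0\<close>
    by (simp add: P_c P_c')

  have "(\<Sum>j=1..n. \<Sum>k=1..n. (P c j - P c k)\<^sup>2) < (\<Sum>j=1..n. \<Sum>k=1..n. (P c' j - P c' k)\<^sup>2)"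
  proof (intro sum_strict_mono_ex1 ballI)
    have "(\<Sum>k=1..n. (P c u - P c k)\<^sup>2) < (\<Sum>k=1..n. (P c' u - P c' k)\<^sup>2)"
      using P_le P_less \<open>u \<in> {1..n}\<close>
      by (intro sum_strict_mono_ex1 ballI bexI[of _ 1])
        (auto simp: abs_le_square_iff power2_strict_mono)
    then show "\<exists>j\<in>{1..n}. (\<Sum>k=1..n. (P c j - P c k)\<^sup>2) < (\<Sum>k=1..n. (P c' j - P c' k)\<^sup>2)"
      using \<open>u \<in> {1..n}\<close> by blast
  qed (use P_le in \<open>auto intro!: sum_mono simp: abs_le_square_iff\<close>)
  moreover have "(\<Sum>k=1..n. (partial_sum c' k - partial_sum c' (n + 1 - k))\<^sup>2)
      = (\<Sum>k=1..n. (partial_sum c k - partial_sum c (n + 1 - k))\<^sup>2)"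
    using antisym by (intro sum.cong refl) simp
  \<comment> \<open>The factor 4 matches the reflection identity; the equal antisymmetric terms then
    cancel.\<close>
  ultimately have "4 * (2 * (real n)\<^sup>2 * var_partial_sum n c)
      < 4 * (2 * (real n)\<^sup>2 * var_partial_sum n c')"
    unfolding var_partial_sum_pairs[OF \<open>n > 0\<close>] sum_pair_diff_reflection P_def
    by (simp only: add_less_cancel_right)
  then have "var_partial_sum n c < var_partial_sum n c'"
    using \<open>n > 0\<close> by simp
  moreover have "\<forall>k\<in>{2..half_up n}. c' k > c' (n + 2 - k)"
    using d'_eq d_nz unfolding d'_def u_def by (metis zero_less_abs_iff diff_gt_0_iff_gt)
  ultimately show ?thesis
    by blast
qed

end
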